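(* Let $n,k,t$ be integers with $n\ge 3$, $0<2t\le k\le 2^{n-1}$ and $\frac{1}{24}\le 2^{-n}t\le \frac{1}{24}+\frac{7}{64}$. Then every $S\subset\{0,1\}^n$ with $|S|=k$ and $\mathrm{Type}(S)=t$ satisfies $\theta(n,S)\ge 2^n f(2^{-n}k)$; equivalently $\theta(n,k,t)\ge 2^n f(2^{-n}k)$.
   Context: $Q_n$ is the hypercube graph on $\{0,1\}^n$ (vertices adjacent iff they differ in exactly one coordinate). For $S\subset\{0,1\}^n$, $\theta(n,S)$ is the number of edges of $Q_n$ with exactly one endpoint in $S$. A half plane of $Q_n$ is a set $\{x\in\{0,1\}^n: x_i=a\}$ for some $1\le i\le n$, $a\in\{0,1\}$ (there are $2n$ of them). $\mathrm{Type}(S)=\min_H |S\cap H|$ over all half planes $H$. $\theta(n,k,t)=\min\{\theta(n,S): S\subset\{0,1\}^n, |S|=k, \mathrm{Type}(S)=t\}$. $f(x)=\frac34-\frac{64}{7}\left(x-\frac12\right)^2$ for real $x$. *)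

theory Defs
  imports Complex_Main "HOL-Library.FuncSet" "HOL-Library.Extended_Nat" "HOL-Library.Extended_Real"
begin

definition cube :: "nat \<Rightarrow> (nat \<Rightarrow> nat) set" where
  "cube n = {1..n} \<rightarrow>\<^sub>E {0, 1}"

definition cube_edges :: "nat \<Rightarrow> (nat \<Rightarrow> nat) set set" where
  "cube_edges n =
     {{x, y} | x y. x \<in> cube n \<and> y \<in> cube n \<and> card {i \<in> {1..n}. x i \<noteq> y i} = 1}"

definition edge_boundary :: "nat \<Rightarrow> (nat \<Rightarrow> nat) set \<Rightarrow> nat" where
  "edge_boundary n S = card {e \<in> cube_edges n. card (e \<inter> S) = 1}"

definition half_plane :: "nat \<Rightarrow> nat \<Rightarrow> nat \<Rightarrow> (nat \<Rightarrow> nat) set" where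
  "half_plane n i a = {x \<in> cube n. x i = a}"

definition half_planes :: "nat \<Rightarrow> (nat \<Rightarrow> nat) set set" where
  "half_planes n = {half_plane n i a | i a. i \<in> {1..n} \<and> a \<in> {0, 1}}"

definition cube_type :: "nat \<Rightarrow> (nat \<Rightarrow> nat) set \<Rightarrow> nat" where
  "cube_type n S = Min ((\<lambda>H. card (S \<inter> H)) ` half_planes n)"

(* Taken in enat, so that the minimum is \<infinity> when no set has the given size and type
   (on nat, the infimum of the empty set would be 0). *)
definition min_edge_boundary :: "nat \<Rightarrow> nat \<Rightarrow> nat \<Rightarrow> enat" where
  "min_edge_boundary n k t =
     Inf {enat (edge_boundary n S) | S. S \<subseteq> cube n \<and> card S = k \<and> cube_type n S = t}"

definition f_bound :: "real \<Rightarrow> real" where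
  "f_bound x = 3 / 4 - 64 / 7 * (x - 1 / 2)\<^sup>2"

end

theory Submission
  imports Defs
begin

text \<open>
  Split \<open>S\<close> along a coordinate whose half plane realises the type, into parts of sizes \<open>t\<close> and
  \<open>k - t\<close> in cubes of dimension \<open>m = n - 1\<close>; at least \<open>k - 2t\<close> boundary edges run between the
  parts.  The edge-isoperimetric inequality bounds the boundary inside each part by
  \<open>2\<^sup>m T(j / 2\<^sup>m)\<close>, where \<open>j\<close> is the size of the part and \<open>T\<close> the Takagi function.
  What remains is an inequality for \<open>T\<close>, which follows from the piecewise linear lower
  bounds \<open>T(x) \<ge> x\<close> on \<open>[0,2/3]\<close>, \<open>T(x) \<ge> 2x\<close> on \<open>[0,1/3]\<close>, \<open>T(x) \<ge> 3x\<close> on \<open>[0,1/6]\<close> and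
  \<open>T(x) \<ge> 1/2\<close> on \<open>[1/6,5/6]\<close>; these imply each other through the functional equations
  \<open>T(x) = T(1 - x)\<close> and \<open>T(x) = x + T(2x) / 2\<close> for \<open>x \<le> 1/2\<close>.
\<close>

section \<open>The discrete Takagi function\<close>

text \<open>The sum of the binary digit sums of all numbers below \<open>k\<close>, which is the largest number of
  edges spanned by \<open>k\<close> vertices of a cube.\<close>

fun digit_total :: "nat \<Rightarrow> nat" where
  "digit_total k =
     (if k \<le> 1 then 0 else digit_total (k div 2) + digit_total ((k + 1) div 2) + k div 2)"

declare digit_total.simps [simp del]

lemma digit_total_0 [simp]: "digit_total 0 = 0"
  and digit_total_1 [simp]: "digit_total (Suc 0) = 0"
  by (simp_all add: digit_total.simps)

lemma digit_total_even: "digit_total (2 * q) = 2 * digit_total q + q"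
  by (cases "q = 0") (simp_all add: digit_total.simps[of "2 * q"])

lemma digit_total_odd: "digit_total (2 * q + 1) = digit_total q + digit_total (q + 1) + q"
  by (cases "q = 0") (simp_all add: digit_total.simps[of "2 * q + 1"] digit_total.simps[of "Suc (2 * q)"])

text \<open>Halving reduces each parity case to smaller sums. When both numbers are odd, the
  rounded-down half of one is paired with the rounded-up half of the other, and
  \<open>2 * min p q \<le> min p (q + 1) + min (p + 1) q\<close> absorbs the rounding.\<close>

lemma digit_total_superadditive:
  "digit_total i + digit_total j + min i j \<le> digit_total (i + j)"
proof (induction "i + j" arbitrary: i j rule: less_induct)
  case less
  show ?case
  proof (cases "i = 0 \<or> j = 0")
    case True
    then show ?thesis by auto
  next
    case False
    obtain p where p: "i = 2 * p \<or> i = 2 * p + 1" by (meson oddE evenE)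
    obtain q where q: "j = 2 * q \<or> j = 2 * q + 1" by (meson oddE evenE)
    note IH = less[of "p" "q"] less[of "p" "q + 1"] less[of "p + 1" "q"]
    consider (ee) "i = 2 * p" "j = 2 * q" | (eo) "i = 2 * p" "j = 2 * q + 1"
      | (oe) "i = 2 * p + 1" "j = 2 * q" | (oo) "i = 2 * p + 1" "j = 2 * q + 1"
      using p q by blast
    then show ?thesis
    proof cases
      case ee
      then have "digit_total (i + j) = 2 * digit_total (p + q) + (p + q)"
        using digit_total_even[of "p + q"] by (simp add: algebra_simps)
      moreover have "digit_total p + digit_total q + min p q \<le> digit_total (p + q)"
        using IH(1) ee False by simp
      ultimately show ?thesis using ee by (simp add: digit_total_even)
    next
      case eo
      then have "digit_total (i + j) = digit_total (p + q) + digit_total (p + q + 1) + (p + q)"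
        using digit_total_odd[of "p + q"] by (simp add: algebra_simps)
      moreover have "digit_total p + digit_total q + min p q \<le> digit_total (p + q)"
        using IH(1) eo False by simp
      moreover have "digit_total p + digit_total (q + 1) + min p (q + 1) \<le> digit_total (p + q + 1)"
        using IH(2) eo False by simp
      ultimately show ?thesis
        unfolding eo digit_total_even digit_total_odd by linarith
    next
      case oe
      then have "digit_total (i + j) = digit_total (p + q) + digit_total (p + q + 1) + (p + q)"
        using digit_total_odd[of "p + q"] by (simp add: algebra_simps)
      moreover have "digit_total p + digit_total q + min p q \<le> digit_total (p + q)"
        using IH(1) oe False by simp
      moreover have "digit_total (p + 1) + digit_total q + min (p + 1) q \<le> digit_total (p + q + 1)"
        using IH(3) oe False by simp
      ultimately show ?thesis
        unfolding oe digit_total_even digit_total_odd by linarith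
    next
      case oo
      then have "digit_total (i + j) = 2 * digit_total (p + q + 1) + (p + q + 1)"
        using digit_total_even[of "p + q + 1"] by (simp add: algebra_simps)
      moreover have "digit_total p + digit_total (q + 1) + min p (q + 1) \<le> digit_total (p + q + 1)"
        using IH(2) oo by simp
      moreover have "digit_total (p + 1) + digit_total q + min (p + 1) q \<le> digit_total (p + q + 1)"
        using IH(3) oo by simp
      ultimately show ?thesis
        unfolding oo digit_total_odd by linarith
    qed
  qed
qed

text \<open>\<open>takagi m j\<close> is \<open>2\<^sup>m T(j / 2\<^sup>m)\<close> for the Takagi function \<open>T\<close>.\<close>

definition takagi :: "nat \<Rightarrow> nat \<Rightarrow> int" where
  "takagi m j = int m * int j - 2 * int (digit_total j)"

lemma takagi_zero [simp]: "takagi m 0 = 0"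
  by (simp add: takagi_def)

text \<open>For \<open>j \<le> 2 ^ m\<close> this is T(x) = x + T(2x)/2 at x = j/2^(m+1), multiplied
  by 2^(m+1).\<close>

lemma takagi_Suc: "takagi (Suc m) j = int j + takagi m j"
  by (simp add: takagi_def algebra_simps)

lemma takagi_even: "takagi (Suc m) (2 * j) = 2 * takagi m j"
  unfolding takagi_def digit_total_even by (simp add: algebra_simps)

lemma takagi_odd: "takagi (Suc m) (2 * j + 1) = takagi m j + takagi m (j + 1) + 1"
  unfolding takagi_def digit_total_odd by (simp add: algebra_simps)

text \<open>The symmetry T(x) = T(1 - x). Both arguments have the same parity; in the odd case
  complementation swaps the neighbours, \<open>p\<close> with \<open>q + 1\<close> and
  \<open>p + 1\<close> with \<open>q\<close>.\<close>

lemma takagi_compl: "i + j = 2 ^ m \<Longrightarrow> takagi m i = takagi m j"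
proof (induction m arbitrary: i j)
  case 0
  then have "i = 0 \<and> j = 1 \<or> i = 1 \<and> j = 0" by auto
  then show ?case by (auto simp: takagi_def)
next
  case (Suc m)
  show ?case
  proof (cases "even i")
    case True
    moreover have "even j"
      using Suc.prems True by (metis even_add even_mult_iff even_numeral power_Suc)
    ultimately obtain p q where pq: "i = 2 * p" "j = 2 * q" by (auto elim!: evenE)
    then have "p + q = 2 ^ m" using Suc.prems by simp
    from Suc.IH[OF this] show ?thesis by (simp add: pq takagi_even)
  next
    case False
    moreover have "odd j"
      using Suc.prems False by (metis even_add even_mult_iff even_numeral power_Suc)
    ultimately obtain p q where pq: "i = 2 * p + 1" "j = 2 * q + 1" by (auto elim!: oddE)
    then have "p + (q + 1) = 2 ^ m" "p + 1 + q = 2 ^ m" using Suc.prems by simp_all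
    from this[THEN Suc.IH] show ?thesis unfolding pq takagi_odd by simp
  qed
qed

lemma takagi_nonneg: "j \<le> 2 ^ m \<Longrightarrow> 0 \<le> takagi m j"
proof (induction m arbitrary: j)
  case 0
  then show ?case by (cases j) (auto simp: takagi_def)
next
  case (Suc m)
  show ?case
  proof (cases "j \<le> 2 ^ m")
    case True
    then show ?thesis using Suc.IH[of j] by (simp add: takagi_Suc)
  next
    case False
    then have "takagi (Suc m) j = takagi (Suc m) (2 ^ Suc m - j)"
      using Suc.prems by (intro takagi_compl) simp
    then show ?thesis using Suc.IH[of "2 ^ Suc m - j"] False by (simp add: takagi_Suc)
  qed
qed

section \<open>Piecewise linear lower bounds for the Takagi function\<close>

text \<open>The bounds feed each other, hence the joint induction: slope 1 on [0, 2/3] gives slope 2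
  on [0, 1/3] at the next level, and slope 2 gives slope 1 between 1/2 and 2/3 at the next
  level.\<close>

lemma takagi_lower_1_2:
  "(3 * j \<le> 2 * 2 ^ m \<longrightarrow> int j \<le> takagi m j) \<and> (3 * j \<le> 2 ^ m \<longrightarrow> 2 * int j \<le> takagi m j)"
proof (induction m arbitrary: j)
  case 0
  show ?case by (cases j) auto
next
  case (Suc m)
  have "int j \<le> takagi (Suc m) j" if j: "3 * j \<le> 2 * 2 ^ Suc m"
  proof (cases "j \<le> 2 ^ m")
    case True
    then show ?thesis using takagi_nonneg[of j m] by (simp add: takagi_Suc)
  next
    case False
    define i where "i = j - 2 ^ m"
    have i: "j = 2 ^ m + i" "3 * i \<le> 2 ^ m"
      using False j by (auto simp: i_def)
    \<comment> \<open>Reflection at level \<open>Suc m\<close> takes \<open>j\<close> to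
      \<open>r\<close>; reflection at level \<open>m\<close> takes \<open>r\<close> to the excess
      \<open>i\<close>, where slope 2 is available.\<close>
    define r where "r = 2 ^ m - i"
    have r: "i + r = 2 ^ m" using i by (simp add: r_def)
    have "takagi (Suc m) j = takagi (Suc m) r"
      using i r by (intro takagi_compl) simp
    also have "\<dots> = int r + takagi m i"
      using takagi_compl[OF r] by (simp add: takagi_Suc)
    finally have "takagi (Suc m) j = int r + takagi m i" .
    moreover have "int j = int i + int r + int i" using i r by linarith
    ultimately show ?thesis using Suc.IH[of i] i(2) by linarith
  qed
  then show ?case using Suc.IH[of j] by (auto simp: takagi_Suc)
qed

lemmas takagi_ge = takagi_lower_1_2 [THEN conjunct1, rule_format]
lemmas takagi_ge_2 = takagi_lower_1_2 [THEN conjunct2, rule_format]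

lemma takagi_ge_3: "6 * j \<le> 2 ^ m \<Longrightarrow> 3 * int j \<le> takagi m j"
proof (cases m)
  case 0
  then show "6 * j \<le> 2 ^ m \<Longrightarrow> ?thesis" by (cases j) simp_all
next
  case (Suc m')
  then show "6 * j \<le> 2 ^ m \<Longrightarrow> ?thesis" using takagi_ge_2[of j m'] by (simp add: takagi_Suc)
qed

text \<open>By symmetry let 1/6 \<le> x \<le> 1/2. Then 1 - 2x \<le> 2/3, so T(2x) = T(1 - 2x) \<ge>
  1 - 2x and x + T(2x)/2 \<ge> 1/2.\<close>

lemma takagi_ge_half:
  assumes "2 ^ m \<le> 6 * j" "6 * j \<le> 5 * 2 ^ m"
  shows "2 ^ m \<le> 2 * takagi m j"
proof (cases m)
  case 0
  then show ?thesis using assms by simp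
next
  case (Suc m')
  have *: "2 ^ m' \<le> takagi m i" if "2 ^ m' \<le> 3 * i" "i \<le> 2 ^ m'" for i
  proof -
    have "takagi m' i = takagi m' (2 ^ m' - i)"
      using that by (intro takagi_compl) simp
    moreover have "3 * (2 ^ m' - i) \<le> 2 * 2 ^ m'" using that by linarith
    from takagi_ge[OF this] have "2 ^ m' - int i \<le> takagi m' (2 ^ m' - i)"
      using that by (simp add: of_nat_diff)
    ultimately show ?thesis by (simp add: Suc takagi_Suc)
  qed
  show ?thesis
  proof (cases "j \<le> 2 ^ m'")
    case True
    then show ?thesis using *[of j] assms by (simp add: Suc)
  next
    case False
    have "takagi m j = takagi m (2 ^ m - j)"
      using assms by (intro takagi_compl) simp
    then show ?thesis using *[of "2 ^ m - j"] assms False by (simp add: Suc)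
  qed
qed

text \<open>Doubling carries [1/12, 5/12] to [1/6, 5/6], where T \<ge> 1/2; hence T(x) \<ge> x +
  1/4.\<close>

lemma takagi_quarter:
  assumes "2 ^ m \<le> 6 * j" "6 * j \<le> 5 * 2 ^ m"
  shows "2 * int j + 2 ^ m \<le> 2 * takagi (Suc m) j"
  using takagi_ge_half[OF assms] by (simp add: takagi_Suc)

text \<open>For x in [5/12, 1/2] the point 1 - 2x lies in [0, 1/6], where slope 3 holds; hence T(x)
  \<ge> 3/2 - 2x.\<close>

lemma takagi_near_half:
  assumes "5 * 2 ^ m \<le> 6 * j" "j \<le> 2 ^ m"
  shows "3 * 2 ^ m - 2 * int j \<le> takagi (Suc m) j"
proof -
  have "takagi m j = takagi m (2 ^ m - j)"
    using assms by (intro takagi_compl) simp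
  moreover have "6 * (2 ^ m - j) \<le> 2 ^ m" using assms by linarith
  from takagi_ge_3[OF this] have "3 * (2 ^ m - int j) \<le> takagi m (2 ^ m - j)"
    using assms by (simp add: of_nat_diff)
  ultimately show ?thesis by (simp add: takagi_Suc)
qed

text \<open>Doubling twice with reflections cancels the linear terms: T(x) = 1/2 + T(4x - 1)/4 on
  [1/4, 1/2].\<close>

lemma takagi_second_quarter:
  assumes "2 ^ m \<le> j" "j \<le> 2 * 2 ^ m"
  shows "takagi (Suc (Suc m)) j = 2 * 2 ^ m + takagi m (j - 2 ^ m)"
proof -
  have "takagi (Suc m) j = takagi (Suc m) (2 * 2 ^ m - j)"
    using assms by (intro takagi_compl) simp
  moreover have "takagi m (2 * 2 ^ m - j) = takagi m (j - 2 ^ m)"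
    using assms by (intro takagi_compl) simp
  ultimately show ?thesis
    using assms by (simp add: takagi_Suc of_nat_diff)
qed

section \<open>Edge isoperimetry in the cube\<close>

definition flip :: "'i \<Rightarrow> ('i \<Rightarrow> nat) \<Rightarrow> 'i \<Rightarrow> nat" where
  "flip i x = x(i := 1 - x i)"

text \<open>A boundary edge is coded by its inner endpoint and its direction. An arbitrary set
  \<open>J\<close> of free coordinates lets an induction drop coordinates without renaming.\<close>

definition boundary :: "'i set \<Rightarrow> ('i \<Rightarrow> nat) set \<Rightarrow> (('i \<Rightarrow> nat) \<times> 'i) set" where
  "boundary J A = {(x, i). x \<in> A \<and> i \<in> J \<and> flip i x \<notin> A}"

lemma finite_boundary [intro]: "finite J \<Longrightarrow> finite A \<Longrightarrow> finite (boundary J A)"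
  by (rule finite_subset[of _ "A \<times> J"]) (auto simp: boundary_def)

lemma flip_flip: "x i \<in> {0, 1} \<Longrightarrow> flip i (flip i x) = x"
  by (auto simp: flip_def)

text \<open>Truncated subtraction gives \<open>1 - v \<noteq> v\<close> for every natural
  \<open>v\<close>, not only for bits.\<close>

lemma flip_neq: "x l \<noteq> flip i x l \<longleftrightarrow> l = i"
  unfolding flip_def by (simp, presburger)

lemma card_slices:
  assumes "finite A" "\<forall>x\<in>A. x i \<in> {0, 1::nat}" "a \<in> {0, 1}"
  shows "card A = card {x \<in> A. x i = a} + card {x \<in> A. x i = 1 - a}"
proof -
  have "A = {x \<in> A. x i = a} \<union> {x \<in> A. x i = 1 - a}" using assms by auto
  then show ?thesis
    using assms card_Un_disjoint[of "{x \<in> A. x i = a}" "{x \<in> A. x i = 1 - a}"] by force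
qed

text \<open>Edges in directions from \<open>J\<close> stay inside a slice. In direction
  \<open>i\<close>, each point of \<open>A1\<close> outside the flipped copy of \<open>A0\<close>
  contributes an edge; these are collected in \<open>D\<close>.\<close>

lemma card_boundary_split:
  assumes "finite J" "i \<notin> J" "finite A" "\<forall>x\<in>A. x i \<in> {0, 1}" and a: "a \<in> {0, 1}"
  defines "A0 \<equiv> {x \<in> A. x i = a}" and "A1 \<equiv> {x \<in> A. x i = 1 - a}"
  shows "card (boundary J A0) + card (boundary J A1) + (card A1 - card A0)
           \<le> card (boundary (insert i J) A)"
proof -
  define D where "D = (\<lambda>x. (x, i)) ` (A1 - flip i ` A0)"
  have fin: "finite A0" "finite A1" using assms by auto
  have finD: "finite D" using fin by (simp add: D_def)
  have "card A1 - card A0 \<le> card A1 - card (flip i ` A0)"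
    using card_image_le[OF fin(1), of "flip i"] by simp
  also have "\<dots> \<le> card (A1 - flip i ` A0)"
    using fin by (intro diff_card_le_card_Diff) auto
  also have "\<dots> = card D"
    unfolding D_def by (intro card_image[symmetric]) (auto simp: inj_on_def)
  finally have D: "card A1 - card A0 \<le> card D" .
  have neq: "l \<noteq> i" if "l \<in> J" for l using that assms by auto
  have a': "1 - a \<noteq> a" using a by auto
  have sub: "boundary J A0 \<union> boundary J A1 \<union> D \<subseteq> boundary (insert i J) A"
  proof -
    have "boundary J A0 \<union> boundary J A1 \<subseteq> boundary (insert i J) A"
      using neq by (auto simp: boundary_def A0_def A1_def flip_def)
    moreover have "(x, i) \<in> boundary (insert i J) A" if x: "x \<in> A1" "x \<notin> flip i ` A0" for x
    proof -
      have "x = flip i (flip i x)" using x assms(4) by (intro flip_flip[symmetric]) (auto simp: A1_def)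
      then have "flip i x \<notin> A0" using x by blast
      moreover have "flip i x i = a" using x a by (auto simp: A1_def flip_def)
      ultimately show ?thesis using x by (simp add: boundary_def A0_def A1_def)
    qed
    ultimately show ?thesis by (auto simp: D_def)
  qed
  have "card (boundary J A0 \<union> boundary J A1 \<union> D) = card (boundary J A0) + card (boundary J A1) + card D"
  proof -
    have "(boundary J A0 \<union> boundary J A1) \<inter> D = {}"
      using neq by (auto simp: boundary_def D_def)
    moreover have "boundary J A0 \<inter> boundary J A1 = {}"
      using a' by (auto simp: boundary_def A0_def A1_def)
    ultimately show ?thesis
      using fin finD \<open>finite J\<close> by (simp add: card_Un_disjoint finite_boundary)
  qed
  then show ?thesis
    using D card_mono[OF _ sub] assms(1,3) by (simp add: finite_boundary)
qed

text \<open>Induction over the coordinates, with \<open>a\<close> the value of the smaller slice: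
  superadditivity of \<open>digit_total\<close> is exactly what the edges across the split require.
  The last assumption places \<open>A\<close> in one subcube with free coordinates
  \<open>J\<close>.\<close>

lemma card_boundary_ge:
  assumes "finite J" "finite A" "\<forall>x\<in>A. \<forall>i\<in>J. x i \<in> {0, 1}"
    and "\<forall>x\<in>A. \<forall>y\<in>A. \<forall>i. i \<notin> J \<longrightarrow> x i = y i"
  shows "takagi (card J) (card A) \<le> int (card (boundary J A))"
  using assms
proof (induction J arbitrary: A rule: finite_induct)
  case empty
  then have "\<forall>x\<in>A. \<forall>y\<in>A. x = y" by (auto simp: fun_eq_iff)
  then have "card A \<le> 1"
    using empty.prems(1) by (simp add: card_le_Suc0_iff_eq)
  then have "card A = 0 \<or> card A = 1" by linarith
  then show ?case by (auto simp: takagi_def)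
next
  case (insert i J)
  have bound: "takagi (card (insert i J)) (card A) \<le> int (card (boundary (insert i J) A))"
    if a: "a \<in> {0, 1}" and le: "card {x \<in> A. x i = a} \<le> card {x \<in> A. x i = 1 - a}" for a
  proof -
    let ?A = "\<lambda>a. {x \<in> A. x i = a}"
    have IH: "takagi (card J) (card (?A b)) \<le> int (card (boundary J (?A b)))" for b
    proof (rule insert.IH)
      show "\<forall>x\<in>?A b. \<forall>y\<in>?A b. \<forall>l. l \<notin> J \<longrightarrow> x l = y l"
        using insert.prems(3) by (metis (mono_tags, lifting) insert_iff mem_Collect_eq)
    qed (use insert.prems in auto)
    have card: "card A = card (?A a) + card (?A (1 - a))"
      using insert.prems a by (intro card_slices) auto
    have "digit_total (card (?A a)) + digit_total (card (?A (1 - a))) + card (?A a)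
            \<le> digit_total (card A)"
      using digit_total_superadditive[of "card (?A a)" "card (?A (1 - a))"] le card by simp
    then have "takagi (card (insert i J)) (card A) \<le>
      takagi (card J) (card (?A a)) + takagi (card J) (card (?A (1 - a)))
        + (int (card (?A (1 - a))) - int (card (?A a)))"
      using insert.hyps by (simp add: takagi_def card algebra_simps)
    also have "\<dots> \<le> int (card (boundary J (?A a)) + card (boundary J (?A (1 - a)))
        + (card (?A (1 - a)) - card (?A a)))"
      using IH[of a] IH[of "1 - a"] le by (simp add: of_nat_diff)
    also have "\<dots> \<le> int (card (boundary (insert i J) A))"
      using insert a by (intro of_nat_mono card_boundary_split) auto
    finally show ?thesis .
  qed
  show ?case
    using bound[of 0] bound[of 1] by fastforce
qed

section \<open>From coded edges to the edge boundary of the cube\<close>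

lemma finite_cube [simp]: "finite (cube n)"
  by (simp add: cube_def finite_PiE)

lemma flip_in_cube: "x \<in> cube n \<Longrightarrow> i \<in> {1..n} \<Longrightarrow> flip i x \<in> cube n"
  by (auto simp: cube_def flip_def PiE_iff extensional_def)

text \<open>The edge determines its code: the inner endpoint is its only point in \<open>S\<close>,
  and the direction is where the endpoints differ.\<close>

lemma card_boundary_le_edge_boundary:
  assumes "S \<subseteq> cube n"
  shows "card (boundary {1..n} S) \<le> edge_boundary n S"
  unfolding edge_boundary_def
proof (rule card_inj_on_le[where f = "\<lambda>(x, i). {x, flip i x}"])
  let ?B = "boundary {1..n} S"
  have "x = y \<and> i = j"
    if "(x, i) \<in> ?B" "(y, j) \<in> ?B" and eq: "{x, flip i x} = {y, flip j y}" for x y i j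
  proof -
    have "x \<in> S" "y \<in> S" "flip i x \<notin> S" "flip j y \<notin> S"
      using that by (auto simp: boundary_def)
    then have "x = y" "flip i x = flip j y" using eq by (auto simp: doubleton_eq_iff)
    moreover from this have "i = j" using flip_neq by metis
    ultimately show ?thesis by blast
  qed
  note inj = this
  show "inj_on (\<lambda>(x, i). {x, flip i x}) ?B"
  proof (rule inj_onI)
    fix u v assume uv: "u \<in> ?B" "v \<in> ?B"
      "(case u of (x, i) \<Rightarrow> {x, flip i x}) = (case v of (x, i) \<Rightarrow> {x, flip i x})"
    obtain x i y j where "u = (x, i)" "v = (y, j)" by (cases u, cases v)
    then show "u = v" using inj[of x i y j] uv by (simp only: case_prod_conv)
  qed
  have "{x, flip i x} \<in> {e \<in> cube_edges n. card (e \<inter> S) = 1}" if B: "(x, i) \<in> ?B" for x i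
  proof -
    have *: "x \<in> S" "x \<in> cube n" "i \<in> {1..n}" "flip i x \<notin> S"
      using B assms by (auto simp: boundary_def)
    have "{l \<in> {1..n}. x l \<noteq> flip i x l} = {i}"
      unfolding flip_neq using *(3) by blast
    then have "{x, flip i x} \<in> cube_edges n"
      unfolding cube_edges_def using flip_in_cube[OF *(2,3)] *(2) by fastforce
    moreover have "{x, flip i x} \<inter> S = {x}" using * by auto
    ultimately show ?thesis by simp
  qed
  then show "(\<lambda>(x, i). {x, flip i x}) ` ?B \<subseteq> {e \<in> cube_edges n. card (e \<inter> S) = 1}"
    unfolding image_subset_iff by (intro ballI) (simp only: split_paired_all case_prod_conv)
  have "cube_edges n \<subseteq> Pow (cube n)" by (auto simp: cube_edges_def)
  then have "finite (cube_edges n)" by (rule finite_subset) simp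
  then show "finite {e \<in> cube_edges n. card (e \<inter> S) = 1}" by simp
qed

lemma cube_type_attained:
  assumes "n \<ge> 1"
  obtains i a where "i \<in> {1..n}" "a \<in> {0, 1}" "card (S \<inter> half_plane n i a) = cube_type n S"
proof -
  have eq: "half_planes n = (\<lambda>(i, a). half_plane n i a) ` ({1..n} \<times> {0, 1})"
    unfolding half_planes_def by fastforce
  have "finite (half_planes n)" "half_planes n \<noteq> {}"
    unfolding eq using assms by auto
  then have "cube_type n S \<in> (\<lambda>H. card (S \<inter> H)) ` half_planes n"
    unfolding cube_type_def by (intro Min_in) auto
  then show thesis using that unfolding half_planes_def by force
qed

lemma edge_boundary_ge_takagi:
  assumes S: "S \<subseteq> cube n" and n: "n \<ge> 1" and t: "2 * cube_type n S \<le> card S"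
  shows "takagi (n - 1) (cube_type n S) + takagi (n - 1) (card S - cube_type n S)
           + (int (card S) - 2 * int (cube_type n S)) \<le> int (edge_boundary n S)"
proof -
  obtain i a where i: "i \<in> {1..n}" and a: "a \<in> {0, 1}"
    and type: "card (S \<inter> half_plane n i a) = cube_type n S"
    using cube_type_attained[OF n] .
  define J where "J = {1..n} - {i}"
  let ?A = "\<lambda>a. {x \<in> S. x i = a}"
  have J: "finite J" "i \<notin> J" "insert i J = {1..n}" "card J = n - 1"
    using i by (auto simp: J_def)
  have fin: "finite S" using S finite_cube by (rule finite_subset)
  have val: "x l \<in> {0, 1}" if "x \<in> S" "l \<in> {1..n}" for x l
    using that S unfolding cube_def by (metis PiE_mem subsetD)
  have "S \<inter> half_plane n i a = ?A a" using S by (auto simp: half_plane_def)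
  then have c0: "card (?A a) = cube_type n S" using type by simp
  have "card S = card (?A a) + card (?A (1 - a))"
    using fin val i a by (intro card_slices) auto
  then have c1: "card (?A (1 - a)) = card S - cube_type n S" using c0 by simp
  have "takagi (card J) (card (?A b)) \<le> int (card (boundary J (?A b)))" for b
  proof (rule card_boundary_ge)
    show "\<forall>x\<in>?A b. \<forall>y\<in>?A b. \<forall>l. l \<notin> J \<longrightarrow> x l = y l"
    proof (intro ballI allI impI)
      fix x y l assume xy: "x \<in> ?A b" "y \<in> ?A b" and l: "l \<notin> J"
      show "x l = y l"
      proof (cases "l = i")
        case False
        \<comment> \<open>Outside \<open>{1..n}\<close> members of \<open>cube n\<close> are
          extensional and share the default value.\<close>
        then have "l \<notin> {1..n}" using l by (simp add: J_def)
        then show ?thesis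
          using xy S unfolding cube_def by (metis (mono_tags, lifting) PiE_arb mem_Collect_eq subsetD)
      qed (use xy in auto)
    qed
  qed (use J fin val in \<open>auto simp: J_def\<close>)
  from this[of a] this[of "1 - a"]
  have "takagi (n - 1) (cube_type n S) + takagi (n - 1) (card S - cube_type n S)
      + (int (card S) - 2 * int (cube_type n S))
    \<le> int (card (boundary J (?A a)) + card (boundary J (?A (1 - a)))
      + (card (?A (1 - a)) - card (?A a)))"
    using t unfolding c0 c1 J(4) by simp
  also have "\<dots> \<le> int (card (boundary (insert i J) S))"
    using J fin val i a by (intro of_nat_mono card_boundary_split) auto
  also have "\<dots> \<le> int (edge_boundary n S)"
    using card_boundary_le_edge_boundary[OF S] J(3) by simp
  finally show ?thesis .
qed

section \<open>The numerical inequality\<close>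

text \<open>Here \<open>a\<close>, \<open>b\<close> are the relative sizes of the two parts and
  \<open>p\<close>, \<open>q\<close> stand for T(a), T(b). The left side is 2 f((a + b)/2).\<close>

lemma two_point_inequality:
  fixes a b p q :: real
  assumes a: "a \<le> 29 / 96"
    and p1: "a + 1 / 4 \<le> p"
    and p2: "1 / 4 \<le> a \<Longrightarrow> a \<le> 7 / 24 \<Longrightarrow> 3 * a - 1 / 4 \<le> p"
    and p3: "7 / 24 \<le> a \<Longrightarrow> 5 / 8 \<le> p"
    and q1: "b \<le> 1 / 3 \<Longrightarrow> 2 * b \<le> q"
    and q2: "1 / 3 \<le> b \<Longrightarrow> 1 - b \<le> q"
    and q3: "1 / 2 \<le> b \<Longrightarrow> b \<le> 7 / 12 \<Longrightarrow> 2 * b - 1 / 2 \<le> q"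
    and q4: "7 / 12 \<le> b \<Longrightarrow> 5 / 4 - b \<le> q"
  shows "3 / 2 - 32 / 7 * (1 - a - b)\<^sup>2 \<le> p + q + b - a"
proof -
  have tangent: "c * u - d \<le> u\<^sup>2" if "c * c = 4 * d" for c d u :: real
    using zero_le_power2[of "u - c / 2"] that by (simp add: power2_eq_square algebra_simps)
  define w where "w = (1 / 2 - a)\<^sup>2"
  define v where "v = (1 - a - b)\<^sup>2"
  \<comment> \<open>Since \<open>32 / 7 * (21 / 32) = 3\<close>, this tangent cancels the
    \<open>3 * b\<close> that arises when \<open>b\<close> is added to the bound \<open>q1\<close>
    or \<open>q3\<close>.\<close>
  have v: "21 / 32 * (1 - a - b) - 441 / 4096 \<le> v" unfolding v_def by (rule tangent) simp
  \<comment> \<open>The instance \<open>b = 1 / 2\<close>, \<open>q = 1 / 2\<close> of the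
    goal.\<close>
  have half: "1 / 2 \<le> p - a + 32 / 7 * w"
  proof -
    consider "a \<le> 1 / 4" | "1 / 4 \<le> a" "a \<le> 7 / 24" | "7 / 24 \<le> a" by linarith
    then show ?thesis
    proof cases
      case 1
      then have "1 / 4 * (1 / 4) \<le> w"
        unfolding w_def power2_eq_square by (intro mult_mono) auto
      then show ?thesis using p1 by linarith
    next
      case 2
      \<comment> \<open>The slope satisfies \<open>32 / 7 * (7 / 16) = 2\<close>, cancelling the
        \<open>2 * a\<close> in the bound for \<open>p - a\<close>.\<close>
      have "7 / 16 * (1 / 2 - a) - 49 / 1024 \<le> w" unfolding w_def by (rule tangent) simp
      then show ?thesis using p2[OF 2] by argo
    next
      case 3
      \<comment> \<open>\<open>19 / 96 = 1 / 2 - 29 / 96\<close>; at \<open>a = 29 / 96\<close> the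
        resulting margin is only \<open>1 / 504\<close>.\<close>
      have "19 / 96 * (19 / 96) \<le> w"
        unfolding w_def power2_eq_square using a by (intro mult_mono) auto
      then show ?thesis using p3[OF 3] a by linarith
    qed
  qed
  consider "7 / 12 \<le> b" | "1 / 2 \<le> b" "b \<le> 7 / 12" | "1 / 3 \<le> b" "b \<le> 1 / 2" | "b \<le> 1 / 3"
    by linarith
  then have "3 / 2 - 32 / 7 * v \<le> p + q + b - a"
  proof cases
    case 1
    have "0 \<le> v" by (simp add: v_def)
    then show ?thesis using q4[OF 1] p1 by linarith
  next
    case 2
    show ?thesis
    proof (cases "a \<le> 1 / 4")
      case True
      then show ?thesis using q3[OF 2] p1 v True by argo
    next
      case False
      \<comment> \<open>Moving \<open>b\<close> down to \<open>1/2\<close> decreases the right side minus the left side.\<close>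
      have "w - v = (b - 1 / 2) * (3 / 2 - 2 * a - b)"
        by (simp add: w_def v_def power2_eq_square field_simps)
      also have "\<dots> \<le> (b - 1 / 2) * (21 / 32)"
        using False 2 by (intro mult_left_mono) auto
      finally show ?thesis using half q3[OF 2] by argo
    qed
  next
    case 3
    \<comment> \<open>On this range \<open>q + b \<ge> 1\<close>, as at \<open>b = 1 / 2\<close>, so
      only the square has to be compared.\<close>
    have "w \<le> v" unfolding w_def v_def using a 3 by (intro power_mono) auto
    then show ?thesis using half q2[OF 3(1)] by linarith
  next
    case 4
    then show ?thesis using q1[OF 4] p1 a v by argo
  qed
  then show ?thesis by (simp only: v_def)
qed

text \<open>The factor 4 in \<open>N\<close> makes the quarter \<open>M = N / 4\<close> an integer,
  so all breakpoints become integer inequalities between multiples of \<open>M\<close>,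
  \<open>t\<close> and \<open>j\<close>.\<close>

lemma takagi_two_point:
  fixes m t j :: nat
  defines "N \<equiv> 4 * 2 ^ m :: real"
  assumes t: "N / 12 \<le> real t" "real t \<le> 29 / 96 * N" and tj: "t \<le> j" "t + j \<le> 4 * 2 ^ m"
  shows "N * (3 / 2 - 32 / 7 * (1 - t / N - j / N)\<^sup>2)
           \<le> takagi (m + 2) t + takagi (m + 2) j + real j - real t"
proof -
  have N: "N > 0" "N = real (4 * 2 ^ m)" by (auto simp: N_def)
  define M :: nat where "M = 2 ^ m"
  have NM: "N = 4 * real M" by (simp add: N_def M_def)
  have t1: "M \<le> 3 * t"
  proof -
    have "real M \<le> real (3 * t)" using t by (simp add: NM)
    then show ?thesis by linarith
  qed
  have t2: "24 * t \<le> 29 * M"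
  proof -
    have "real (24 * t) \<le> real (29 * M)" using t by (simp add: NM)
    then show ?thesis by linarith
  qed
  have tj': "t + j \<le> 4 * M" using tj by (simp add: M_def)
  have Mi: "(2::int) ^ m = int M" by (simp add: M_def)
  have compl: "takagi (m + 2) j = takagi (m + 2) (4 * M - j)"
    using tj' by (intro takagi_compl) (simp add: M_def)
  have p1: "int t + int M \<le> takagi (m + 2) t"
    using takagi_quarter[of "Suc m" t] t1 t2 by (simp add: Mi flip: M_def)
  \<comment> \<open>The breakpoint 7/24 between \<open>p2\<close> and \<open>p3\<close> is where 4x
    - 1 = 1/6, so the slope 3 bound hands over to the constant 1/2.\<close>
  have p2: "3 * int t - int M \<le> takagi (m + 2) t" if "M \<le> t" "6 * t \<le> 7 * M"
  proof -
    have "6 * (t - M) \<le> 2 ^ m" using that unfolding M_def by linarith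
    from takagi_ge_3[OF this] show ?thesis
      using takagi_second_quarter[of m t] that by (simp add: Mi of_nat_diff flip: M_def)
  qed
  have p3: "5 * int M \<le> 2 * takagi (m + 2) t" if "7 * M \<le> 6 * t"
  proof -
    have "2 ^ m \<le> 6 * (t - M)" "6 * (t - M) \<le> 5 * 2 ^ m"
      using that t2 unfolding M_def by linarith+
    from takagi_ge_half[OF this] show ?thesis
      using takagi_second_quarter[of m t] that t2 by (simp add: Mi flip: M_def)
  qed
  have q1: "2 * int j \<le> takagi (m + 2) j" if "3 * j \<le> 4 * M"
    using takagi_ge_2[of j "m + 2"] that by (simp add: flip: M_def)
  have q2: "4 * int M - int j \<le> takagi (m + 2) j" if "4 * M \<le> 3 * j"
  proof -
    have "3 * (4 * M - j) \<le> 2 * 2 ^ (m + 2)" using that by (simp flip: M_def)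
    from takagi_ge[OF this] show ?thesis using tj' compl by (simp add: of_nat_diff)
  qed
  have q3: "2 * int j - 2 * int M \<le> takagi (m + 2) j" if "2 * M \<le> j" "3 * j \<le> 7 * M"
  proof -
    have "5 * 2 ^ Suc m \<le> 6 * (4 * M - j)" "4 * M - j \<le> 2 ^ Suc m"
      using that tj' by (simp_all flip: M_def)
    from takagi_near_half[OF this] show ?thesis
      using tj' compl by (simp add: Mi of_nat_diff)
  qed
  \<comment> \<open>The complement of \<open>j\<close> is at least \<open>t\<close>, hence at least
    \<open>N / 12\<close>, which is the left end of the range of
    \<open>takagi_quarter\<close>.\<close>
  have q4: "5 * int M - int j \<le> takagi (m + 2) j" if "7 * M \<le> 3 * j"
  proof -
    have "2 ^ Suc m \<le> 6 * (4 * M - j)" "6 * (4 * M - j) \<le> 5 * 2 ^ Suc m"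
      using that tj' t1 by (simp_all flip: M_def)
    from takagi_quarter[OF this] show ?thesis
      using tj' compl by (simp add: Mi of_nat_diff)
  qed
  have M: "real M = N / 4" by (simp add: NM)
  note scale = pos_le_divide_eq[OF N(1)] pos_divide_le_eq[OF N(1)]
  let ?p = "real_of_int (takagi (m + 2) t) / N" and ?q = "real_of_int (takagi (m + 2) j) / N"
  note rl = of_int_le_iff[where ?'a = real, THEN iffD2]
  have "3 / 2 - 32 / 7 * (1 - t / N - j / N)\<^sup>2 \<le> ?p + ?q + j / N - t / N"
  proof (rule two_point_inequality)
    show "t / N \<le> 29 / 96" using t(2) by (simp add: scale)
    show "t / N + 1 / 4 \<le> ?p"
      using rl[OF p1] N(1) by (simp_all add: scale M algebra_simps)
    show "3 * (t / N) - 1 / 4 \<le> ?p" if "1 / 4 \<le> t / N" "t / N \<le> 7 / 24"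
    proof -
      have "real M \<le> real t" "real (6 * t) \<le> real (7 * M)"
        using that N(1) by (simp_all add: scale M algebra_simps)
      then have "M \<le> t" "6 * t \<le> 7 * M" by linarith+
      from rl[OF p2[OF this]] show ?thesis using N(1) by (simp_all add: scale M algebra_simps)
    qed
    show "5 / 8 \<le> ?p" if "7 / 24 \<le> t / N"
    proof -
      have "real (7 * M) \<le> real (6 * t)" using that N(1) by (simp_all add: scale M algebra_simps)
      then have "7 * M \<le> 6 * t" by linarith
      from rl[OF p3[OF this]] show ?thesis using N(1) by (simp_all add: scale M algebra_simps)
    qed
    show "2 * (j / N) \<le> ?q" if "j / N \<le> 1 / 3"
    proof -
      have "real (3 * j) \<le> real (4 * M)" using that N(1) by (simp_all add: scale M algebra_simps)
      then have "3 * j \<le> 4 * M" by linarith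
      from rl[OF q1[OF this]] show ?thesis using N(1) by (simp_all add: scale M algebra_simps)
    qed
    show "1 - j / N \<le> ?q" if "1 / 3 \<le> j / N"
    proof -
      have "real (4 * M) \<le> real (3 * j)" using that N(1) by (simp_all add: scale M algebra_simps)
      then have "4 * M \<le> 3 * j" by linarith
      from rl[OF q2[OF this]] show ?thesis using N(1) by (simp_all add: scale M algebra_simps)
    qed
    show "2 * (j / N) - 1 / 2 \<le> ?q" if "1 / 2 \<le> j / N" "j / N \<le> 7 / 12"
    proof -
      have "real (2 * M) \<le> real j" "real (3 * j) \<le> real (7 * M)"
        using that N(1) by (simp_all add: scale M algebra_simps)
      then have "2 * M \<le> j" "3 * j \<le> 7 * M" by linarith+
      from rl[OF q3[OF this]] show ?thesis using N(1) by (simp_all add: scale M algebra_simps)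
    qed
    show "5 / 4 - j / N \<le> ?q" if "7 / 12 \<le> j / N"
    proof -
      have "real (7 * M) \<le> real (3 * j)" using that N(1) by (simp_all add: scale M algebra_simps)
      then have "7 * M \<le> 3 * j" by linarith
      from rl[OF q4[OF this]] show ?thesis using N(1) by (simp_all add: scale M algebra_simps)
    qed
  qed
  from mult_left_mono[OF this, of N] N(1) show ?thesis
    by (simp add: distrib_left right_diff_distrib)
qed

section \<open>Deduction of the bound for sets and for the minimum\<close>

theorem theorem1p2:
  fixes n k t :: nat
  assumes "n \<ge> 3"
    and "0 < 2 * t" and "2 * t \<le> k" and "k \<le> 2 ^ (n - 1)"
    and "1 / 24 \<le> real t / 2 ^ n" and "real t / 2 ^ n \<le> 1 / 24 + 7 / 64"
  shows "(\<forall>S. S \<subseteq> cube n \<and> card S = k \<and> cube_type n S = t \<longrightarrow>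
              real (edge_boundary n S) \<ge> 2 ^ n * f_bound (real k / 2 ^ n)) \<and>
         ereal_of_enat (min_edge_boundary n k t) \<ge> ereal (2 ^ n * f_bound (real k / 2 ^ n))"
proof -
  have *: "2 ^ n * f_bound (real k / 2 ^ n) \<le> real (edge_boundary n S)"
    if S: "S \<subseteq> cube n" "card S = k" "cube_type n S = t" for S
  proof -
    obtain m where m: "n = m + 3" using assms(1) by (metis add.commute le_Suc_ex)
    define N :: real where "N = 4 * 2 ^ m"
    have N: "2 ^ n = 2 * N" "0 < N" by (auto simp: N_def m power_add)
    have "N * (3 / 2 - 32 / 7 * (1 - t / N - real (k - t) / N)\<^sup>2)
      \<le> takagi (m + 2) t + takagi (m + 2) (k - t) + real (k - t) - real t"
      unfolding N_def
    proof (rule takagi_two_point)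
      \<comment> \<open>As \<open>N\<close> is half of \<open>2 ^ n\<close>, the bounds on the
        density of \<open>t\<close> double: \<open>2 * (1 / 24 + 7 / 64) = 29 / 96\<close>.\<close>
      show "4 * 2 ^ m / 12 \<le> real t" "real t \<le> 29 / 96 * (4 * 2 ^ m)"
        using assms(5,6) N(2) unfolding N(1) N_def by (auto simp: field_simps)
      show "t \<le> k - t" "t + (k - t) \<le> 4 * 2 ^ m"
        using assms(3,4) by (auto simp: m power_add)
    qed
    also have "\<dots> \<le> real (edge_boundary n S)"
    proof -
      have "takagi (m + 2) t + takagi (m + 2) (k - t) + (int k - 2 * int t) \<le> int (edge_boundary n S)"
        using edge_boundary_ge_takagi[OF S(1)] S(2,3) assms(1,3) by (simp add: m)
      from of_int_le_iff[where ?'a = real, THEN iffD2, OF this] show ?thesis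
        using assms(3) by (simp add: of_nat_diff)
    qed
    also have "N * (3 / 2 - 32 / 7 * (1 - t / N - real (k - t) / N)\<^sup>2) = 2 ^ n * f_bound (real k / 2 ^ n)"
    proof -
      have "1 - t / N - real (k - t) / N = - 2 * (real k / (2 * N) - 1 / 2)"
        using assms(3) by (simp add: of_nat_diff diff_divide_distrib)
      then have "(1 - t / N - real (k - t) / N)\<^sup>2 = 4 * (real k / (2 * N) - 1 / 2)\<^sup>2"
        by (simp only: power_mult_distrib) simp
      then show ?thesis
        unfolding f_bound_def N(1) by (simp only:) (simp add: algebra_simps)
    qed
    finally show ?thesis .
  qed
  have "ereal (2 ^ n * f_bound (real k / 2 ^ n)) \<le> ereal_of_enat (min_edge_boundary n k t)"
  proof (cases "{enat (edge_boundary n S) | S. S \<subseteq> cube n \<and> card S = k \<and> cube_type n S = t} = {}")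
    case True
    then have "min_edge_boundary n k t = \<infinity>"
      unfolding min_edge_boundary_def by (metis Inf_empty top_enat_def)
    then show ?thesis by simp
  next
    case False
    \<comment> \<open>\<open>enat\<close> is well-ordered, so the infimum of a nonempty set is
      attained by some \<open>S\<close>.\<close>
    from wellorder_InfI[OF this[folded ex_in_conv, THEN someI_ex]]
    obtain S where "S \<subseteq> cube n" "card S = k" "cube_type n S = t"
      and "min_edge_boundary n k t = enat (edge_boundary n S)"
      unfolding min_edge_boundary_def by blast
    then show ?thesis using * by simp
  qed
  with * show ?thesis by blast
qed

end
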